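(* Let $k$ be a multiple of $5$ and let $\{a_n\}$ be a $k$-periodic sequence of positive numbers with primitive period $k$. Consider the recurrence $x_{n+2}=\frac{a_n+x_{n+1}}{x_n}$ with positive initial conditions $x_1,x_2$. For $i=1,2,\dots,5$ set $$\phi_i:=\prod_{\substack{1\le n\le k\\ n\equiv i\ (\mathrm{mod}\ 5)}}a_n .$$ If $\phi_i\neq1$ for all $i=1,\dots,5$ and $$\min_{i=1,\dots,5}\{\phi_i\}<1<\max_{i=1,\dots,5}\{\phi_i\},$$ then the recurrence is non-persistent. In fact, for a (nonempty) open set of initial conditions, $\liminf_{n\to\infty}x_n=0$ and $\limsup_{n\to\infty}x_n=+\infty$.
   Context: The recurrence is called persistent if for any sequence $\{x_n\}$ generated by it (with positive initial conditions) there exist two real positive constants $c$ and $C$, depending on the initial conditions, such that $0<c<x_n<C<\infty$ for all $n$. It is non-persistent otherwise. Initial conditions are pairs $(x_1,x_2)$ with $x_1,x_2>0$. *)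

theory Defs
  imports "HOL-Analysis.Analysis" "HOL-Number_Theory.Cong"
begin

text \<open>Sequences are indexed by the positive integers: they are functions on \<open>nat\<close> whose
  value at \<open>0\<close> is never constrained.\<close>

definition has_period :: "(nat \<Rightarrow> real) \<Rightarrow> nat \<Rightarrow> bool" where
  "has_period a k \<longleftrightarrow> k > 0 \<and> (\<forall>n\<ge>1. a (n + k) = a n)"

definition primitive_period :: "(nat \<Rightarrow> real) \<Rightarrow> nat \<Rightarrow> bool" where
  "primitive_period a k \<longleftrightarrow> has_period a k \<and> (\<forall>m. has_period a m \<longrightarrow> k \<le> m)"

definition generated_by :: "(nat \<Rightarrow> real) \<Rightarrow> (nat \<Rightarrow> real) \<Rightarrow> bool" where
  "generated_by a x \<longleftrightarrow> x 1 > 0 \<and> x 2 > 0 \<and> (\<forall>n\<ge>1. x (n + 2) = (a n + x (n + 1)) / x n)"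

definition persistent :: "(nat \<Rightarrow> real) \<Rightarrow> bool" where
  "persistent a \<longleftrightarrow>
     (\<forall>x. generated_by a x \<longrightarrow> (\<exists>c>0. \<exists>C>0. \<forall>n\<ge>1. c < x n \<and> x n < C))"

definition phi :: "(nat \<Rightarrow> real) \<Rightarrow> nat \<Rightarrow> nat \<Rightarrow> real" where
  "phi a k i = (\<Prod>n | 1 \<le> n \<and> n \<le> k \<and> [n = i] (mod 5). a n)"

end

theory Submission
  imports Defs
begin

text \<open>For \<open>a = 1\<close> the map \<open>(x\<^sub>n, x\<^sub>n\<^sub>+\<^sub>1) \<mapsto> (x\<^sub>n\<^sub>+\<^sub>1, x\<^sub>n\<^sub>+\<^sub>2)\<close> has order five, and this
  leaves a trace for other coefficients: five consecutive steps, although they pass through very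
  large values, extend continuously to the corner \<open>(0, 0)\<close> of the positive quadrant and fix it.
  Near this corner they act, to first order, as the diagonal map
  \<open>(u, v) \<mapsto> (u / a\<^sub>m, a\<^sub>m\<^sub>+\<^sub>4 v)\<close>; this is lemma \<open>five_steps\<close>. Since \<open>5\<close> divides \<open>k\<close>, the
  \<open>k\<close> steps that start at time \<open>m\<close> act to first order as
  \<open>(u, v) \<mapsto> (u / \<phi>\<^sub>m, \<phi>\<^sub>m\<^sub>-\<^sub>1 v)\<close>, with indices of \<open>\<phi>\<close> modulo \<open>5\<close>. If
  \<open>\<phi>\<^sub>m\<^sub>-\<^sub>1 < 1 < \<phi>\<^sub>m\<close>, the corner attracts all nearby pairs (\<open>small_pairs_decay\<close>).

  Such an \<open>m\<close> exists: the \<open>\<phi>\<^sub>i\<close> form a cycle that takes values below and above \<open>1\<close> but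
  never \<open>1\<close>, so it jumps over \<open>1\<close> upwards somewhere (\<open>ex_consecutive_phi\<close>). Along a solution
  that is attracted, \<open>x\<^sub>m\<^sub>+\<^sub>k\<^sub>n \<rightarrow> 0\<close>, and
  \<open>x\<^sub>m\<^sub>+\<^sub>2\<^sub>+\<^sub>k\<^sub>n \<ge> a\<^sub>m / x\<^sub>m\<^sub>+\<^sub>k\<^sub>n\<close> then tends to infinity. The pairs
  \<open>(x\<^sub>m, x\<^sub>m\<^sub>+\<^sub>1)\<close> close to the corner form an open set, which pulls back to a nonempty open
  set of initial conditions (\<open>open_initial_conditions\<close>).\<close>

section \<open>Positive solutions\<close>

lemma generated_by_pos:
  assumes "\<forall>n\<ge>1. a n > 0" "generated_by a x" "n \<ge> 1"
  shows "x n > 0"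
proof -
  have "x (Suc n) > 0 \<and> x (Suc (Suc n)) > 0" for n
  proof (induction n)
    case 0
    then show ?case using assms(2) by (simp add: generated_by_def numeral_2_eq_2)
  next
    case (Suc n)
    have "x (Suc n + 2) = (a (Suc n) + x (Suc n + 1)) / x (Suc n)"
      using assms(2) unfolding generated_by_def by (metis le_add1 plus_1_eq_Suc)
    moreover have "a (Suc n) > 0" using assms(1) by simp
    ultimately show ?case using Suc by (simp add: add_pos_pos)
  qed
  then show ?thesis using assms(3) by (metis Suc_le_D One_nat_def)
qed

lemma generated_by_shift:
  assumes "\<forall>n\<ge>1. a n > 0" "has_period a k" "generated_by a x"
  shows "generated_by a (\<lambda>n. x (n + k))"
  unfolding generated_by_def
proof (intro conjI allI impI)
  show "x (1 + k) > 0" "x (2 + k) > 0"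
    using generated_by_pos[OF assms(1,3)] by simp_all
  fix n :: nat assume n: "n \<ge> 1"
  have "x ((n + k) + 2) = (a (n + k) + x ((n + k) + 1)) / x (n + k)"
    using assms(3) n unfolding generated_by_def by simp
  moreover have "a (n + k) = a n" using assms(2) n by (simp add: has_period_def)
  ultimately show "x (n + 2 + k) = (a n + x (n + 1 + k)) / x (n + k)"
    by (simp add: add.commute add.left_commute)
qed

text \<open>Without solutions for given initial conditions, persistence could hold vacuously.\<close>

lemma ex_generated_by:
  assumes "u > 0" "v > 0"
  shows "\<exists>x. generated_by a x \<and> x 1 = u \<and> x 2 = v"
proof -
  \<comment> \<open>\<open>P n\<close> is the pair of the terms with indices \<open>n + 1\<close> and \<open>n + 2\<close>.\<close>
  define P where "P = rec_nat (u, v) (\<lambda>n (y, z). (z, (a (Suc n) + z) / y))"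
  have P0: "P 0 = (u, v)" by (simp add: P_def)
  have PS: "P (Suc n) = (snd (P n), (a (Suc n) + snd (P n)) / fst (P n))" for n
    by (simp add: P_def split: prod.splits)
  define x where "x n = fst (P (n - 1))" for n
  have "x (n + 2) = (a n + x (n + 1)) / x n" if "n \<ge> 1" for n
    using that by (cases n) (simp_all add: x_def PS)
  moreover have "x 1 = u" "x 2 = v"
    using PS[of 0] by (simp_all add: x_def P0)
  ultimately show ?thesis using assms unfolding generated_by_def by blast
qed

text \<open>The step \<open>(x\<^sub>n, x\<^sub>n\<^sub>+\<^sub>1) \<mapsto> (x\<^sub>n\<^sub>+\<^sub>1, x\<^sub>n\<^sub>+\<^sub>2)\<close> is continuous on the
  positive quadrant and maps it onto itself, as \<open>x\<^sub>n\<close> can be recovered from the two terms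
  that follow it. So an open condition on a later pair of terms can be pulled back to the initial
  conditions without becoming empty.\<close>

lemma open_initial_conditions:
  fixes W :: "(real \<times> real) set"
  assumes a: "\<forall>n\<ge>1. a n > 0" and "open W" "W \<noteq> {}" "W \<subseteq> {0<..} \<times> {0<..}"
  shows "\<exists>U. open U \<and> U \<noteq> {} \<and> U \<subseteq> {0<..} \<times> {0<..} \<and>
    (\<forall>x. generated_by a x \<and> (x 1, x 2) \<in> U \<longrightarrow> (x (Suc n), x (Suc (Suc n))) \<in> W)"
  using assms(2-)
proof (induction n arbitrary: W)
  case 0
  then show ?case by (intro exI[of _ W]) (auto simp: numeral_2_eq_2)
next
  case (Suc n)
  define Q :: "(real \<times> real) set" where "Q = {0<..} \<times> {0<..}"
  define T where "T = (\<lambda>p :: real \<times> real. (snd p, (a (Suc n) + snd p) / fst p))"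
  have an: "a (Suc n) > 0" using a by simp
  have "open Q" unfolding Q_def by (intro open_Times open_greaterThan)
  moreover have "continuous_on Q T"
    unfolding T_def by (intro continuous_intros) (auto simp: Q_def)
  ultimately have 1: "open (Q \<inter> T -` W)"
    using \<open>open W\<close> by (intro continuous_open_preimage)
  \<comment> \<open>A preimage of \<open>(v, w)\<close> comes from solving \<open>w = (a\<^sub>n\<^sub>+\<^sub>1 + v) / u\<close> for \<open>u\<close>.\<close>
  obtain v w where vw: "(v, w) \<in> W" using \<open>W \<noteq> {}\<close> by auto
  then have pos: "v > 0" "w > 0" using Suc.prems(3) by auto
  then have "((a (Suc n) + v) / w, v) \<in> Q \<inter> T -` W"
    using an vw by (auto simp: Q_def T_def add_pos_pos)
  then have 2: "Q \<inter> T -` W \<noteq> {}" by blast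
  obtain U where U: "open U" "U \<noteq> {}" "U \<subseteq> {0<..} \<times> {0<..}"
    and UW: "\<And>x. generated_by a x \<Longrightarrow> (x 1, x 2) \<in> U \<Longrightarrow>
        (x (Suc n), x (Suc (Suc n))) \<in> Q \<inter> T -` W"
    using Suc.IH[OF 1 2] unfolding Q_def by blast
  have "(x (Suc (Suc n)), x (Suc (Suc (Suc n)))) \<in> W"
    if x: "generated_by a x" "(x 1, x 2) \<in> U" for x
  proof -
    have "x (Suc n + 2) = (a (Suc n) + x (Suc n + 1)) / x (Suc n)"
      using x(1) unfolding generated_by_def by (metis le_add1 plus_1_eq_Suc)
    then show ?thesis using UW[OF x] by (simp add: T_def)
  qed
  with U show ?case by blast
qed

section \<open>Five steps near the origin\<close>

text \<open>Five steps turn a pair \<open>(u, v)\<close> into \<open>(u F(u,v), v G(u,v))\<close> with rational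
  functions \<open>F\<close> and \<open>G\<close> that are continuous at the origin, where their values are
  \<open>1 / a\<^sub>m\<close> and \<open>a\<^sub>m\<^sub>+\<^sub>4\<close>. The other three coefficients do not appear in these
  values, since each of them is added to a term that is large when \<open>u\<close> and \<open>v\<close> are small. The
  factor \<open>\<epsilon>\<close> leaves room for the deviation of \<open>F\<close> and \<open>G\<close> from their values at the
  origin.\<close>

lemma five_steps:
  assumes a: "\<forall>n\<ge>1. a n > 0" and m: "m \<ge> 1" and \<epsilon>: "\<epsilon> > (1::real)"
  shows "\<exists>\<delta>>0. \<forall>x. generated_by a x \<and> x m < \<delta> \<and> x (m + 1) < \<delta> \<longrightarrow>
    x (m + 5) \<le> \<epsilon> / a m * x m \<and> x (m + 6) \<le> \<epsilon> * a (m + 4) * x (m + 1)"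
proof -
  define p q r s t where "p = a m" and "q = a (m+1)" and "r = a (m+2)" and "s = a (m+3)"
    and "t = a (m+4)"
  have pos: "p > 0" "q > 0" "r > 0" "s > 0" "t > 0"
    using a m by (auto simp: p_def q_def r_def s_def t_def)
  define F where "F = (\<lambda>z :: real \<times> real.
    (s * snd z * (p + snd z) + r * fst z * snd z + q * fst z + p + snd z) /
    ((p + snd z) * (q * fst z + p + snd z)))"
  define G where "G = (\<lambda>z :: real \<times> real.
    (p + snd z) * (t + fst z * F z) / (r * fst z * snd z + q * fst z + p + snd z))"
  have fst0: "(fst \<longlongrightarrow> 0) (nhds (0::real) \<times>\<^sub>F nhds (0::real))"
    and snd0: "(snd \<longlongrightarrow> 0) (nhds (0::real) \<times>\<^sub>F nhds (0::real))"
    by (rule filterlim_fst filterlim_snd)+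
  have "(F \<longlongrightarrow> (s * 0 * (p + 0) + r * 0 * 0 + q * 0 + p + 0) / ((p + 0) * (q * 0 + p + 0)))
      (nhds 0 \<times>\<^sub>F nhds 0)"
    unfolding F_def using pos by (intro tendsto_intros fst0 snd0) auto
  then have F: "(F \<longlongrightarrow> 1 / p) (nhds 0 \<times>\<^sub>F nhds 0)" using pos by simp
  have "(G \<longlongrightarrow> (p + 0) * (t + 0 * (1 / p)) / (r * 0 * 0 + q * 0 + p + 0)) (nhds 0 \<times>\<^sub>F nhds 0)"
    unfolding G_def using pos by (intro tendsto_intros fst0 snd0 F) auto
  then have G: "(G \<longlongrightarrow> t) (nhds 0 \<times>\<^sub>F nhds 0)" using pos by simp
  have "\<forall>\<^sub>F z in nhds 0 \<times>\<^sub>F nhds 0. F z < \<epsilon> / p \<and> G z < \<epsilon> * t"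
    using order_tendstoD(2)[OF F, of "\<epsilon> / p"] order_tendstoD(2)[OF G, of "\<epsilon> * t"] pos \<epsilon>
    by (simp add: eventually_conj_iff divide_strict_right_mono)
  then obtain P where P: "eventually P (nhds (0::real))"
      "\<And>u v. P u \<Longrightarrow> P v \<Longrightarrow> F (u, v) < \<epsilon> / p \<and> G (u, v) < \<epsilon> * t"
    unfolding eventually_prod_same by blast
  from P(1) obtain \<delta> where \<delta>: "\<delta> > 0" "\<And>u. dist u 0 < \<delta> \<Longrightarrow> P u"
    unfolding eventually_nhds_metric by blast
  show ?thesis
  proof (intro exI[of _ \<delta>] conjI allI impI; (elim conjE)?)
    show "\<delta> > 0" by fact
  next
    fix x assume x: "generated_by a x" "x m < \<delta>" "x (m + 1) < \<delta>"
    define u v where "u = x m" and "v = x (m + 1)"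
    have uv: "u > 0" "v > 0"
      using generated_by_pos[OF a x(1)] m by (auto simp: u_def v_def)
    have FG: "F (u, v) < \<epsilon> / p" "G (u, v) < \<epsilon> * t"
      using P(2)[of u v] \<delta>(2)[of u] \<delta>(2)[of v] uv x by (auto simp: u_def v_def)
    have rec: "x (n + 2) = (a n + x (n + 1)) / x n" if "n \<ge> m" for n
      using x(1) m that by (simp add: generated_by_def)
    have x3: "x (m + 2) = (p + v) / u"
      and rec4: "x (m + 3) = (q + x (m + 2)) / v"
      and rec5: "x (m + 4) = (r + x (m + 3)) / x (m + 2)"
      and rec6: "x (m + 5) = (s + x (m + 4)) / x (m + 3)"
      and rec7: "x (m + 6) = (t + x (m + 5)) / x (m + 4)"
      using rec[of m] rec[of "m + 1"] rec[of "m + 2"] rec[of "m + 3"] rec[of "m + 4"]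
      by (simp_all add: p_def q_def r_def s_def t_def u_def v_def eval_nat_numeral)
    have x4: "x (m + 3) = (q * u + p + v) / (u * v)"
      using rec4 x3 uv by (simp add: field_simps)
    have x5: "x (m + 4) = (r * u * v + q * u + p + v) / (v * (p + v))"
    proof -
      have "x (m + 4) = (r + (q * u + p + v) / (u * v)) / ((p + v) / u)"
        using rec5 x3 x4 by simp
      moreover have "(r + N / (u * v)) / (D / u) = (r * u * v + N) / (v * D)" if "D > 0" for N D
        using uv that by (simp add: field_simps)
      ultimately show ?thesis using uv pos by (simp add: add_pos_pos add.assoc)
    qed
    have nz: "p + v > 0" "q * u + p + v > 0" "r * u * v + q * u + p + v > 0"
      using uv pos by (auto intro!: add_pos_pos)
    have x6: "x (m + 5) = u * F (u, v)"
    proof -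
      have "x (m + 5) = (s + (r * u * v + q * u + p + v) / (v * (p + v))) / ((q * u + p + v) / (u * v))"
        using rec6 x4 x5 by simp
      moreover have "(s + M / (v * D)) / (N / (u * v)) = u * ((s * v * D + M) / (D * N))"
        if "D > 0" "N > 0" for M N D
        using uv that by (simp add: field_simps)
      ultimately show ?thesis using nz by (simp add: F_def add.assoc)
    qed
    have x7: "x (m + 6) = v * G (u, v)"
    proof -
      have "x (m + 6) = (t + u * F (u, v)) / ((r * u * v + q * u + p + v) / (v * (p + v)))"
        using rec7 x5 x6 by simp
      then show ?thesis using uv nz by (simp add: G_def)
    qed
    show "x (m + 5) \<le> \<epsilon> / a m * x m"
      using x6 mult_left_mono[OF less_imp_le[OF FG(1)], of u] uv
      by (simp add: p_def u_def mult.commute)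
    show "x (m + 6) \<le> \<epsilon> * a (m + 4) * x (m + 1)"
      using x7 mult_left_mono[OF less_imp_le[OF FG(2)], of v] uv
      by (simp add: t_def v_def mult.commute)
  qed
qed

text \<open>A factor \<open>\<epsilon>\<close> arbitrarily close to \<open>1\<close> is enough for any fixed number of blocks of five
  steps: one block leaves the pair as small as required for the next one, up to a constant, and the
  induction spends \<open>\<surd>\<epsilon>\<close> on the earlier blocks and \<open>\<surd>\<epsilon>\<close> on the last.\<close>

lemma iterated_five_steps:
  assumes a: "\<forall>n\<ge>1. a n > 0" and m: "m \<ge> 1" and "\<epsilon> > (1::real)"
  shows "\<exists>\<delta>>0. \<forall>x. generated_by a x \<and> x m < \<delta> \<and> x (m + 1) < \<delta> \<longrightarrow>
    x (m + 5 * j) \<le> \<epsilon> / (\<Prod>l<j. a (m + 5 * l)) * x m \<and>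
    x (m + 5 * j + 1) \<le> \<epsilon> * (\<Prod>l<j. a (m + 4 + 5 * l)) * x (m + 1)"
  using \<open>\<epsilon> > 1\<close>
proof (induction j arbitrary: \<epsilon>)
  case 0
  have "\<epsilon> \<ge> 1" using 0 by simp
  then show ?case
    using generated_by_pos[OF a] m by (intro exI[of _ 1]) (auto intro!: less_imp_le)
next
  case (Suc j)
  define s where "s = sqrt \<epsilon>"
  have s: "s > 1" "s * s = \<epsilon>" using Suc.prems by (auto simp: s_def)
  define A B where "A = (\<Prod>l<j. a (m + 5 * l))" and "B = (\<Prod>l<j. a (m + 4 + 5 * l))"
  have pos: "A > 0" "B > 0" using a m by (auto simp: A_def B_def intro!: prod_pos)
  obtain \<delta>1 where \<delta>1: "\<delta>1 > 0"
    "\<And>x. generated_by a x \<Longrightarrow> x m < \<delta>1 \<Longrightarrow> x (m + 1) < \<delta>1 \<Longrightarrow>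
      x (m + 5 * j) \<le> s / A * x m \<and> x (m + 5 * j + 1) \<le> s * B * x (m + 1)"
    using Suc.IH[OF s(1)] unfolding A_def B_def by blast
  obtain \<delta>2 where \<delta>2: "\<delta>2 > 0"
    "\<And>x. generated_by a x \<Longrightarrow> x (m + 5 * j) < \<delta>2 \<Longrightarrow> x (m + 5 * j + 1) < \<delta>2 \<Longrightarrow>
      x (m + 5 * j + 5) \<le> s / a (m + 5 * j) * x (m + 5 * j) \<and>
      x (m + 5 * j + 6) \<le> s * a (m + 5 * j + 4) * x (m + 5 * j + 1)"
    using five_steps[OF a _ s(1), of "m + 5 * j"] m by auto
  define \<delta> where "\<delta> = min \<delta>1 (min (\<delta>2 / (s / A)) (\<delta>2 / (s * B)))"
  show ?case
  proof (intro exI[of _ \<delta>] conjI allI impI; (elim conjE)?)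
    show "\<delta> > 0" using \<delta>1(1) \<delta>2(1) s pos by (simp add: \<delta>_def)
  next
    fix x assume x: "generated_by a x" "x m < \<delta>" "x (m + 1) < \<delta>"
    have j: "x (m + 5 * j) \<le> s / A * x m" "x (m + 5 * j + 1) \<le> s * B * x (m + 1)"
      using \<delta>1(2)[of x] x by (auto simp: \<delta>_def)
    have c: "s / A > 0" "s * B > 0" using s pos by auto
    have "s / A * x m < \<delta>2" "s * B * x (m + 1) < \<delta>2"
      using x(2,3) pos_less_divide_eq[OF c(1), of "x m" \<delta>2]
        pos_less_divide_eq[OF c(2), of "x (m + 1)" \<delta>2]
      by (simp_all add: \<delta>_def mult.commute)
    with j have small: "x (m + 5 * j) < \<delta>2" "x (m + 5 * j + 1) < \<delta>2" by auto
    have aj: "a (m + 5 * j) > 0" "a (m + 5 * j + 4) > 0" using a m by auto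
    have "x (m + 5 * j + 5) \<le> s / a (m + 5 * j) * (s / A * x m)"
      using \<delta>2(2)[OF x(1) small] mult_left_mono[OF j(1), of "s / a (m + 5 * j)"] s aj by simp
    also have "\<dots> = s * s / (A * a (m + 5 * j)) * x m" by (simp add: mult_ac)
    finally show "x (m + 5 * Suc j) \<le> \<epsilon> / (\<Prod>l<Suc j. a (m + 5 * l)) * x m"
      using s(2) by (simp add: A_def add.commute add.left_commute)
    have "x (m + 5 * j + 6) \<le> s * a (m + 5 * j + 4) * x (m + 5 * j + 1)"
      using \<delta>2(2)[OF x(1) small] by simp
    also have "\<dots> \<le> s * a (m + 5 * j + 4) * (s * B * x (m + 1))"
      using s aj by (intro mult_left_mono j(2)) simp
    also have "\<dots> = s * s * (B * a (m + 4 + 5 * j)) * x (m + 1)"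
      by (simp add: ac_simps)
    finally show "x (m + 5 * Suc j + 1) \<le> \<epsilon> * (\<Prod>l<Suc j. a (m + 4 + 5 * l)) * x (m + 1)"
      using s(2) by (simp add: B_def[symmetric] add.commute[of 6])
  qed
qed

section \<open>Contraction over a period\<close>

text \<open>By periodicity, the product over one residue class may start at any \<open>i \<ge> 1\<close>: moving the start
  by five trades the factor \<open>a\<^sub>i\<close> for \<open>a\<^sub>i\<^sub>+\<^sub>k = a\<^sub>i\<close>. So the factors gained over a period from
  any starting time are values of \<open>phi\<close>.\<close>

lemma prod_residue_class_eq_phi:
  assumes "has_period a (5 * K)" "i \<ge> 1"
  shows "(\<Prod>j<K. a (i + 5 * j)) = phi a (5 * K) i"
  using assms(2)
proof (induction i rule: less_induct)
  case (less i)
  show ?case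
  proof (cases "i \<le> 5")
    case True
    have "bij_betw (\<lambda>j. i + 5 * j) {..<K} {n. 1 \<le> n \<and> n \<le> 5 * K \<and> [n = i] (mod 5)}"
    proof (rule bij_betw_byWitness[where f' = "\<lambda>n. (n - i) div 5"])
      show "(\<lambda>n. (n - i) div 5) ` {n. 1 \<le> n \<and> n \<le> 5 * K \<and> [n = i] (mod 5)} \<subseteq> {..<K}"
        using less.prems by (auto simp: cong_def)
      show "\<forall>n\<in>{n. 1 \<le> n \<and> n \<le> 5 * K \<and> [n = i] (mod 5)}. i + 5 * ((n - i) div 5) = n"
      proof safe
        fix n assume n: "1 \<le> n" "n \<le> 5 * K" "[n = i] (mod 5)"
        have "i \<le> n"
        proof (rule ccontr)
          assume "\<not> i \<le> n"
          then have "5 dvd i - n" "0 < i - n"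
            using n(3) mod_eq_dvd_iff_nat[of n i 5] by (simp_all add: cong_def)
          then have "5 \<le> i - n" by (rule dvd_imp_le)
          with n(1) True show False by linarith
        qed
        moreover from this have "5 dvd n - i"
          using n(3) mod_eq_dvd_iff_nat[of i n 5] by (simp add: cong_def)
        ultimately show "i + 5 * ((n - i) div 5) = n" by simp
      qed
    qed (use less.prems True in \<open>auto simp: cong_def\<close>)
    then show ?thesis unfolding phi_def by (rule prod.reindex_bij_betw)
  next
    case False
    define i' where "i' = i - 5"
    have i': "i = i' + 5" "i' \<ge> 1" using False by (auto simp: i'_def)
    have "K > 0" using assms(1) by (simp add: has_period_def)
    then obtain L where L: "K = Suc L" using gr0_conv_Suc by auto
    have "(\<Prod>j<K. a (i + 5 * j)) = (\<Prod>j<L. a (i' + 5 * Suc j)) * a (i' + 5 * K)"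
      by (simp add: L i' ac_simps)
    also have "a (i' + 5 * K) = a i'" using assms(1) i' by (simp add: has_period_def)
    also have "(\<Prod>j<L. a (i' + 5 * Suc j)) * a i' = (\<Prod>j<K. a (i' + 5 * j))"
      unfolding L by (subst prod.lessThan_Suc_shift) (simp add: mult.commute)
    also have "\<dots> = phi a (5 * K) i'" using less.IH[of i'] i' by simp
    also have "\<dots> = phi a (5 * K) i" by (simp add: phi_def i' cong_def)
    finally show ?thesis .
  qed
qed

text \<open>If every value below \<open>1\<close> were followed by another one, then, going once around the cycle of
  residues from the minimum, all values would be below \<open>1\<close>.\<close>

lemma ex_consecutive_phi:
  assumes ne: "\<forall>i\<in>{1..5}. phi a k i \<noteq> 1"
    and "Min (phi a k ` {1..5}) < 1" "1 < Max (phi a k ` {1..5})"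
  shows "\<exists>i\<ge>1. phi a k i < 1 \<and> phi a k (Suc i) > 1"
proof (rule ccontr)
  assume contra: "\<not> ?thesis"
  have phi_mod: "phi a k i = phi a k j" if "i mod 5 = j mod 5" for i j
    using that by (simp add: phi_def cong_def)
  have ne': "phi a k i \<noteq> 1" for i
  proof -
    define j where "j = (i + 4) mod 5 + 1"
    have "j \<in> {1..5}" by (simp add: j_def)
    moreover have "i mod 5 = j mod 5" unfolding j_def by presburger
    ultimately show ?thesis using ne phi_mod by metis
  qed
  obtain p where p: "p \<in> {1..5}" "phi a k p < 1"
    using assms(2) by (subst (asm) Min_less_iff) auto
  obtain q where q: "q \<in> {1..5}" "phi a k q > 1"
    using assms(3) by (subst (asm) Max_gr_iff) auto
  have "phi a k (p + n) < 1" for n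
  proof (induction n)
    case (Suc n)
    have "p + n \<ge> 1" using p by simp
    with Suc contra have "\<not> phi a k (Suc (p + n)) > 1" by blast
    with ne'[of "Suc (p + n)"] show ?case by simp
  qed (use p in simp)
  from this[of "q + 5 - p"] have "phi a k (q + 5) < 1" using p q by simp
  moreover have "phi a k (q + 5) = phi a k q" by (rule phi_mod) simp
  ultimately show False using q by simp
qed

text \<open>Both first-order factors \<open>1 / \<phi>\<^sub>m\<close> and \<open>\<phi>\<^sub>m\<^sub>+\<^sub>4\<close> are below \<open>1\<close>, hence so are
  \<open>\<epsilon> / \<phi>\<^sub>m\<close> and \<open>\<epsilon> \<phi>\<^sub>m\<^sub>+\<^sub>4\<close> for some \<open>\<epsilon> > 1\<close>, and a pair that has come close to the
  origin stays close from one period to the next. A solution shifted by a period is again a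
  solution, so the same estimate applies in every period.\<close>

lemma small_pairs_decay:
  assumes a: "\<forall>n\<ge>1. a n > 0" and per: "has_period a k" and k: "5 dvd k" and m: "m \<ge> 1"
    and phi: "phi a k m > 1" "phi a k (m + 4) < 1"
  shows "\<exists>\<delta>>0. \<forall>x. generated_by a x \<and> x m < \<delta> \<and> x (m + 1) < \<delta> \<longrightarrow>
    (\<lambda>n. x (m + k * n)) \<longlonglongrightarrow> 0"
proof -
  obtain K where K: "k = 5 * K" using k by (rule dvdE)
  define A B where "A = phi a k m" and "B = phi a k (m + 4)"
  have A: "(\<Prod>l<K. a (m + 5 * l)) = A" and B: "(\<Prod>l<K. a (m + 4 + 5 * l)) = B"
    using prod_residue_class_eq_phi[of a K] per m by (simp_all add: A_def B_def K)
  have "B > 0" unfolding B[symmetric] using a by (intro prod_pos) auto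
  have AB: "A > 1" "B < 1" using phi by (simp_all add: A_def B_def)
  obtain \<epsilon> where \<epsilon>: "\<epsilon> > 1" "\<epsilon> < min A (1 / B)"
    using dense[of 1 "min A (1 / B)"] AB \<open>B > 0\<close> by auto
  define c where "c = max (\<epsilon> / A) (\<epsilon> * B)"
  have c: "c > 0" "c < 1" using \<epsilon> AB \<open>B > 0\<close> by (auto simp: c_def max_def field_simps)
  obtain \<delta> where \<delta>: "\<delta> > 0" and "\<And>x. generated_by a x \<Longrightarrow> x m < \<delta> \<Longrightarrow> x (m + 1) < \<delta> \<Longrightarrow>
      x (m + k) \<le> \<epsilon> / A * x m \<and> x (m + k + 1) \<le> \<epsilon> * B * x (m + 1)"
    using iterated_five_steps[OF a m \<epsilon>(1), of K] unfolding A B K by blast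
  note step = this(2)
  have pow: "x (m + k * n) \<le> c ^ n * x m"
    if "generated_by a x" "x m < \<delta>" "x (m + 1) < \<delta>" for x n
    using that
  proof (induction n arbitrary: x)
    case (Suc n)
    have pos: "x m > 0" "x (m + 1) > 0" using generated_by_pos[OF a Suc.prems(1)] m by auto
    have "\<epsilon> / A * x m \<le> c * x m" "\<epsilon> * B * x (m + 1) \<le> c * x (m + 1)"
      using pos by (simp_all only: mult_le_cancel_right_pos) (simp_all add: c_def)
    then have "x (m + k) \<le> c * x m" "x (m + k + 1) \<le> c * x (m + 1)"
      using step[OF Suc.prems] by linarith+
    moreover have "c * x m \<le> x m" "c * x (m + 1) \<le> x (m + 1)" using c pos by auto
    ultimately have le: "x (m + k) \<le> c * x m" "x (m + k) < \<delta>" "x (m + 1 + k) < \<delta>"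
      using Suc.prems by (auto simp: add_ac)
    have "x (m + k * n + k) \<le> c ^ n * x (m + k)"
      using Suc.IH[OF generated_by_shift[OF a per Suc.prems(1)]] le by simp
    also have "\<dots> \<le> c ^ n * (c * x m)" using le(1) c by (intro mult_left_mono) auto
    finally show ?case by (simp add: algebra_simps)
  qed simp
  have "(\<lambda>n. x (m + k * n)) \<longlonglongrightarrow> 0"
    if x: "generated_by a x" "x m < \<delta>" "x (m + 1) < \<delta>" for x
  proof (rule tendsto_sandwich)
    show "\<forall>\<^sub>F n in sequentially. 0 \<le> x (m + k * n)"
      using generated_by_pos[OF a x(1)] m by (intro always_eventually allI less_imp_le) simp
    show "\<forall>\<^sub>F n in sequentially. x (m + k * n) \<le> c ^ n * x m" using pow[OF x] by simp
    show "(\<lambda>n. c ^ n * x m) \<longlonglongrightarrow> 0"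
      using c by (intro tendsto_mult_left_zero LIMSEQ_power_zero) auto
  qed simp
  with \<delta> show ?thesis by blast
qed

text \<open>Two steps after a small term \<open>x\<^sub>i\<close> comes a large one, as
  \<open>x\<^sub>i\<^sub>+\<^sub>2 \<ge> a\<^sub>i / x\<^sub>i\<close>; along the given subsequence the numerator is constantly \<open>a\<^sub>m\<close>.\<close>

lemma liminf_limsup_of_vanishing_subsequence:
  assumes a: "\<forall>n\<ge>1. a n > 0" and per: "has_period a k" and m: "m \<ge> 1"
    and x: "generated_by a x" and lim: "(\<lambda>n. x (m + k * n)) \<longlonglongrightarrow> 0"
  shows "liminf (\<lambda>n. ereal (x n)) = 0" "limsup (\<lambda>n. ereal (x n)) = \<infinity>"
proof -
  have k: "k > 0" using per by (simp add: has_period_def)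
  have pos: "x n > 0" if "n \<ge> 1" for n using generated_by_pos[OF a x that] .
  have mono: "strict_mono (\<lambda>n. l + k * n)" for l using k by (simp add: strict_mono_def)
  have "liminf (\<lambda>n. ereal (x n)) \<le> liminf ((\<lambda>n. ereal (x n)) \<circ> (\<lambda>n. m + k * n))"
    by (rule liminf_subseq_mono[OF mono])
  also have "\<dots> = 0"
    using lim by (intro lim_imp_Liminf) (simp_all add: o_def zero_ereal_def)
  finally have "liminf (\<lambda>n. ereal (x n)) \<le> 0" .
  moreover have "liminf (\<lambda>n. ereal (x n)) \<ge> 0"
    using pos by (intro Liminf_bounded eventually_sequentiallyI[of 1]) (auto intro: less_imp_le)
  ultimately show "liminf (\<lambda>n. ereal (x n)) = 0" by (rule antisym)
  have per': "a (m + k * n) = a m" for n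
  proof (induction n)
    case (Suc n)
    have "a (m + k * n + k) = a (m + k * n)" using per m by (simp add: has_period_def)
    with Suc show ?case by (simp add: algebra_simps)
  qed simp
  have "filterlim (\<lambda>n. inverse (x (m + k * n))) at_top sequentially"
    using lim pos m by (intro filterlim_inverse_at_top) simp_all
  then have "filterlim (\<lambda>n. a m / x (m + k * n)) at_top sequentially"
    using filterlim_tendsto_pos_mult_at_top[OF tendsto_const, of "a m"] a m
    by (simp add: divide_inverse)
  moreover have "a m / x (m + k * n) \<le> x (m + 2 + k * n)" for n
  proof -
    have "x (m + k * n + 2) = (a (m + k * n) + x (m + k * n + 1)) / x (m + k * n)"
      using x m by (simp add: generated_by_def)
    then have "x (m + 2 + k * n) = (a m + x (m + k * n + 1)) / x (m + k * n)"
      by (simp add: per' add_ac)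
    then show ?thesis
      using pos[of "m + k * n"] pos[of "m + k * n + 1"] m by (simp add: divide_right_mono)
  qed
  ultimately have "filterlim (\<lambda>n. x (m + 2 + k * n)) at_top sequentially"
    by (auto intro: filterlim_at_top_mono)
  then have "((\<lambda>n. ereal (x (m + 2 + k * n))) \<longlongrightarrow> \<infinity>) sequentially"
    by (simp add: tendsto_PInfty_eq_at_top)
  then have "\<infinity> = limsup ((\<lambda>n. ereal (x n)) \<circ> (\<lambda>n. m + 2 + k * n))"
    by (intro lim_imp_Limsup[symmetric]) (simp_all add: o_def)
  also have "\<dots> \<le> limsup (\<lambda>n. ereal (x n))"
    by (rule limsup_subseq_mono[OF mono])
  finally show "limsup (\<lambda>n. ereal (x n)) = \<infinity>" by simp
qed

theorem theorem6:
  fixes a :: "nat \<Rightarrow> real" and k :: nat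
  assumes "5 dvd k"
    and "\<forall>n\<ge>1. a n > 0"
    and "primitive_period a k"
    and "\<forall>i\<in>{1..5}. phi a k i \<noteq> 1"
    and "Min (phi a k ` {1..5}) < 1"
    and "1 < Max (phi a k ` {1..5})"
  shows "\<not> persistent a \<and>
    (\<exists>U :: (real \<times> real) set. open U \<and> U \<noteq> {} \<and> U \<subseteq> {0<..} \<times> {0<..} \<and>
      (\<forall>x. generated_by a x \<and> (x 1, x 2) \<in> U \<longrightarrow>
        liminf (\<lambda>n. ereal (x n)) = 0 \<and> limsup (\<lambda>n. ereal (x n)) = \<infinity>))"
proof -
  have per: "has_period a k" using assms(3) by (simp add: primitive_period_def)
  obtain i where i: "i \<ge> 1" "phi a k i < 1" "phi a k (Suc i) > 1"
    using ex_consecutive_phi[OF assms(4-6)] by blast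
  have "phi a k (Suc i + 4) = phi a k i" by (simp add: phi_def cong_def)
  then obtain \<delta> where \<delta>: "\<delta> > 0" and decay: "\<And>x. generated_by a x \<Longrightarrow> x (Suc i) < \<delta> \<Longrightarrow>
      x (Suc i + 1) < \<delta> \<Longrightarrow> (\<lambda>n. x (Suc i + k * n)) \<longlonglongrightarrow> 0"
    using small_pairs_decay[OF assms(2) per assms(1), of "Suc i"] i by auto
  define W :: "(real \<times> real) set" where "W = {0<..<\<delta>} \<times> {0<..<\<delta>}"
  have "(\<delta> / 2, \<delta> / 2) \<in> W" using \<delta> by (simp add: W_def)
  then have "open W" "W \<noteq> {}" "W \<subseteq> {0<..} \<times> {0<..}"
    by (auto simp: W_def intro: open_Times)
  then obtain U where U: "open U" "U \<noteq> {}" "U \<subseteq> {0<..} \<times> {0<..}"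
    and UW: "\<And>x. generated_by a x \<Longrightarrow> (x 1, x 2) \<in> U \<Longrightarrow> (x (Suc i), x (Suc (Suc i))) \<in> W"
    using open_initial_conditions[OF assms(2), of W i] by blast
  have osc: "liminf (\<lambda>n. ereal (x n)) = 0" "limsup (\<lambda>n. ereal (x n)) = \<infinity>"
    if x: "generated_by a x" "(x 1, x 2) \<in> U" for x
  proof -
    have "(\<lambda>n. x (Suc i + k * n)) \<longlonglongrightarrow> 0"
      using UW[OF x] by (intro decay x) (auto simp: W_def)
    then show "liminf (\<lambda>n. ereal (x n)) = 0" "limsup (\<lambda>n. ereal (x n)) = \<infinity>"
      using liminf_limsup_of_vanishing_subsequence[OF assms(2) per _ x(1), of "Suc i"] by simp_all
  qed
  have "\<not> persistent a"
  proof
    assume pers: "persistent a"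
    obtain u v where uv: "(u, v) \<in> U" using U(2) by auto
    then have "u > 0" "v > 0" using U(3) by auto
    then obtain x where x: "generated_by a x" "x 1 = u" "x 2 = v"
      using ex_generated_by by blast
    then obtain c where c: "c > 0" "\<And>n. n \<ge> 1 \<Longrightarrow> c < x n"
      using pers unfolding persistent_def by blast
    have "ereal c \<le> liminf (\<lambda>n. ereal (x n))"
      using c by (intro Liminf_bounded eventually_sequentiallyI[of 1]) (auto intro: less_imp_le)
    then show False using osc(1)[OF x(1)] x uv c(1) by simp
  qed
  with U osc show ?thesis by blast
qed

end
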